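(* Let $F$ be R. Thompson's group, let $K$ be a field and let $K[F]$ be the group ring of $F$ over $K$. For any integer $m\ge1$ there exists a non-zero solution $(u_0,u_1,\ldots,u_m)\in K[F]^{m+1}$ to the system of equations $$(1-x_0)u_0=(1-x_1)u_1=\cdots=(1-x_m)u_m.$$
   Context: R. Thompson's group $F$ is the group given by the presentation $\langle x_0,x_1,x_2,\ldots \mid x_jx_i=x_ix_{j+1}\ (0\le i<j)\rangle$. A solution is non-zero if at least one of the $u_i$ is non-zero. *)

theory Defs
  imports Main "HOL-Library.Poly_Mapping"
begin

text \<open>
  A letter \<open>(i, True)\<close> stands for the generator \<open>x\<^sub>i\<close> and \<open>(i, False)\<close> for its inverse.
  Thompson's group \<open>F\<close> is the quotient of the monoid of words by the least monoid congruence
  containing the free cancellations and the relations \<open>x\<^sub>j x\<^sub>i = x\<^sub>i x\<^sub>j\<^sub>+\<^sub>1\<close> for \<open>i < j\<close>.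
\<close>

type_synonym letter = "nat \<times> bool"

inductive F_equiv :: "letter list \<Rightarrow> letter list \<Rightarrow> bool" where
  refl: "F_equiv u u"
| sym: "F_equiv u v \<Longrightarrow> F_equiv v u"
| trans: "F_equiv u v \<Longrightarrow> F_equiv v w \<Longrightarrow> F_equiv u w"
| append: "F_equiv u u' \<Longrightarrow> F_equiv v v' \<Longrightarrow> F_equiv (u @ v) (u' @ v')"
| cancel: "F_equiv [(i, b), (i, \<not> b)] []"
| relation: "i < j \<Longrightarrow> F_equiv [(j, True), (i, True)] [(i, True), (Suc j, True)]"

quotient_type thompson_F = "letter list" / F_equiv
proof (rule equivpI)
  show "reflp F_equiv" by (rule reflpI) (rule F_equiv.refl)
  show "symp F_equiv" by (rule sympI) (rule F_equiv.sym)
  show "transp F_equiv" by (rule transpI) (rule F_equiv.trans)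
qed

definition inv_word :: "letter list \<Rightarrow> letter list" where
  "inv_word w = rev (map (\<lambda>(i, b). (i, \<not> b)) w)"

lemma inv_word_append: "inv_word (u @ v) = inv_word v @ inv_word u"
  by (simp add: inv_word_def)

lemma inv_word_inv_word: "inv_word (inv_word w) = w"
  by (simp add: inv_word_def rev_map case_prod_unfold comp_def)

lemma F_equiv_inv_word_left: "F_equiv (inv_word w @ w) []"
proof (induction w)
  case Nil
  show ?case by (simp add: inv_word_def F_equiv.refl)
next
  case (Cons a w)
  obtain i b where a: "a = (i, b)" by (cases a)
  have "F_equiv ([(i, \<not> b), (i, b)] @ w) ([] @ w)"
    using F_equiv.append[OF F_equiv.cancel[of i "\<not> b"] F_equiv.refl[of w]] by simp
  then have "F_equiv (inv_word w @ ([(i, \<not> b), (i, b)] @ w)) (inv_word w @ ([] @ w))"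
    by (rule F_equiv.append[OF F_equiv.refl])
  then have "F_equiv (inv_word w @ ([(i, \<not> b), (i, b)] @ w)) []"
    using F_equiv.trans[OF _ Cons.IH] by simp
  then show ?case
    by (simp add: a inv_word_def)
qed

lemma F_equiv_inv_word: "F_equiv u v \<Longrightarrow> F_equiv (inv_word u) (inv_word v)"
proof -
  assume uv: "F_equiv u v"
  have 1: "F_equiv (inv_word u @ (v @ inv_word v)) (inv_word u @ [])"
    using F_equiv.append[OF F_equiv.refl F_equiv_inv_word_left[of "inv_word v"]]
    by (simp add: inv_word_inv_word)
  have "F_equiv (inv_word u @ v) (inv_word u @ u)"
    using F_equiv.append[OF F_equiv.refl F_equiv.sym[OF uv]] .
  then have "F_equiv (inv_word u @ v) []"
    by (rule F_equiv.trans[OF _ F_equiv_inv_word_left])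
  then have 2: "F_equiv ((inv_word u @ v) @ inv_word v) ([] @ inv_word v)"
    by (rule F_equiv.append[OF _ F_equiv.refl])
  show ?thesis
    using F_equiv.trans[OF F_equiv.sym[OF 1]] 2 by simp
qed

text \<open>
  The group law of \<open>F\<close> is written additively (without being commutative), because
  \<^typ>\<open>'a \<Rightarrow>\<^sub>0 'k\<close> carries the convolution product \<open>f * g\<close> of the monoid algebra when \<open>'a\<close> is a
  \<^class>\<open>monoid_add\<close>.  So \<^typ>\<open>thompson_F \<Rightarrow>\<^sub>0 'k\<close> is the group ring \<open>K[F]\<close>, and
  \<open>x\<^sub>j x\<^sub>i\<close> in multiplicative notation is \<open>x\<^sub>j + x\<^sub>i\<close> in \<^typ>\<open>thompson_F\<close>.
\<close>

instantiation thompson_F :: group_add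
begin

lift_definition zero_thompson_F :: thompson_F is "[]" .

lift_definition plus_thompson_F :: "thompson_F \<Rightarrow> thompson_F \<Rightarrow> thompson_F" is "(@)"
  by (rule F_equiv.append)

lift_definition uminus_thompson_F :: "thompson_F \<Rightarrow> thompson_F" is inv_word
  by (rule F_equiv_inv_word)

definition minus_thompson_F :: "thompson_F \<Rightarrow> thompson_F \<Rightarrow> thompson_F" where
  "minus_thompson_F a b = a + - b"

instance
proof
  fix a b c :: thompson_F
  show "a + b + c = a + (b + c)"
    by transfer (simp add: F_equiv.refl)
  show "0 + a = a"
    by transfer (simp add: F_equiv.refl)
  show "a + 0 = a"
    by transfer (simp add: F_equiv.refl)
  show "- a + a = 0"
    by transfer (rule F_equiv_inv_word_left)
  show "a + - b = a - b"
    by (simp add: minus_thompson_F_def)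
qed

end

lift_definition gen :: "nat \<Rightarrow> thompson_F" is "\<lambda>i. [(i, True)]" .

lemma gen_relation: "i < j \<Longrightarrow> gen j + gen i = gen i + gen (Suc j)"
  by transfer (simp add: F_equiv.relation)

definition xgen :: "nat \<Rightarrow> (thompson_F \<Rightarrow>\<^sub>0 'k::field)" where
  "xgen i = Poly_Mapping.single (gen i) 1"

end

theory Submission
  imports Defs HOL.Rat
begin

text \<open>
  Common right multiples of \<open>1 - x\<^sub>b, \<dots>, 1 - x\<^sub>b\<^sub>+\<^sub>m\<close> are found by induction on \<open>m\<close>: if \<open>r\<close> is
  one for \<open>1 - x\<^sub>b\<^sub>+\<^sub>1, \<dots>, 1 - x\<^sub>b\<^sub>+\<^sub>m\<close>, supported on positive words in the \<open>x\<^sub>i\<close> with \<open>i > b\<close>, one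
  needs \<open>v \<noteq> 0\<close> with \<open>r v\<close> in the right ideal of \<open>1 - x\<^sub>b\<close>.  Conjugation by \<open>x\<^sub>b\<^sup>n\<close> shifts the
  indices in \<open>r\<close> by \<open>n\<close>, and the shifted element commutes, up to a further shift, with any
  homogeneous element when \<open>n\<close> is large.  This permits multiplying \<open>r\<close> on the right, modulo that
  ideal, so that its homogeneous components vanish one at a time.  The factors used are positive,
  and products of non-zero positive elements do not vanish: distinct positive elements of \<open>F\<close> act
  differently by strictly increasing maps on the rationals, which yields unique products.
\<close>

subsection \<open>Positive words\<close>

definition word :: "nat list \<Rightarrow> thompson_F" where
  "word us = (\<Sum>i\<leftarrow>us. gen i)"

lemma word_simps [simp]:
  "word [] = 0" "word (i # us) = gen i + word us" "word (us @ vs) = word us + word vs"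
  by (simp_all add: word_def)

lemma gen_word_commute:
  "(\<And>i. i \<in> set us \<Longrightarrow> i < j) \<Longrightarrow> gen j + word us = word us + gen (j + length us)"
proof (induction us arbitrary: j)
  case (Cons i us)
  have "gen j + word (i # us) = gen i + (gen (Suc j) + word us)"
    using gen_relation[of i j] Cons.prems by (simp flip: add.assoc)
  also have "gen (Suc j) + word us = word us + gen (Suc j + length us)"
    using Cons.prems by (intro Cons.IH) (simp add: less_SucI)
  finally show ?case
    by (simp add: add.assoc)
qed simp

text \<open>A letter of \<open>vs\<close> gains one for every smaller letter it passes, so the total
  shift depends only on the length of \<open>us\<close>.\<close>

lemma word_commute:
  "(\<And>i j. i \<in> set us \<Longrightarrow> j \<in> set vs \<Longrightarrow> i < j) \<Longrightarrow>
    word vs + word us = word us + word (map (\<lambda>j. j + length us) vs)"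
proof (induction vs)
  case (Cons j vs)
  have "word (j # vs) + word us = gen j + word us + word (map (\<lambda>j. j + length us) vs)"
    using Cons by (simp add: add.assoc)
  also have "gen j + word us = word us + gen (j + length us)"
    using Cons.prems by (intro gen_word_commute) auto
  finally show ?case
    by (simp add: add.assoc)
qed simp

lemma word_sorted_exists:
  "\<exists>vs. word vs = word us \<and> sorted vs"
proof (induction us)
  case (Cons j us)
  \<comment> \<open>Insertion sort: a letter passing a smaller \<open>i\<close> continues as its
    successor. The lower bound keeps the result sorted once \<open>i\<close> is put in
    front.\<close>
  have insert: "\<exists>vs. word vs = word (j # us) \<and> sorted vs \<and> (\<forall>v\<in>set vs. \<exists>u\<in>set (j # us). u \<le> v)"
    if "sorted us" for j us
    using that
  proof (induction us arbitrary: j)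
    case Nil
    show ?case by (rule exI[of _ "[j]"]) simp
  next
    case (Cons i us)
    show ?case
    proof (cases "j \<le> i")
      case True
      with Cons.prems show ?thesis by (intro exI[of _ "j # i # us"]) auto
    next
      case False
      obtain vs where vs: "word vs = word (Suc j # us)" "sorted vs"
          "\<forall>v\<in>set vs. \<exists>u\<in>set (Suc j # us). u \<le> v"
        using Cons.IH[of "Suc j"] Cons.prems by auto
      have "word (i # vs) = word (j # i # us)"
        using False vs(1) by (simp add: gen_relation flip: add.assoc)
      moreover have "\<forall>v\<in>set vs. i \<le> v"
        using vs(3) Cons.prems False by fastforce
      ultimately show ?thesis
        using vs(2) by (intro exI[of _ "i # vs"]) auto
    qed
  qed
  from Cons obtain vs where "word vs = word us" "sorted vs" by blast
  with insert[of vs j] show ?case by auto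
qed (auto intro: exI[of _ "[]"])

subsection \<open>The length homomorphism\<close>

text \<open>The total exponent; all defining relations preserve it. It tells homogeneous elements of
  different degrees apart.\<close>

lift_definition len :: "thompson_F \<Rightarrow> int" is "\<lambda>w. \<Sum>(i, b)\<leftarrow>w. if b then 1 else - 1"
  subgoal for u v by (induction rule: F_equiv.induct) auto
  done

lemma len_simps [simp]:
  "len 0 = 0" "len (g + h) = len g + len h" "len (gen i) = 1" "len (word us) = int (length us)"
proof -
  show [simp]: "len 0 = 0" by transfer simp
  show [simp]: "len (g + h) = len g + len h" for g h by transfer simp
  show [simp]: "len (gen i) = 1" for i by transfer simp
  show "len (word us) = int (length us)" by (induction us) simp_all
qed

subsection \<open>Unique products of positive elements\<close>

text \<open>The usual piecewise linear model of \<open>F\<close>: a generator is the identity up to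
  \<open>i\<close>, has slope 2 on \<open>[i, i + 1]\<close> and translates by 1 from there
  on.\<close>

fun letter_act :: "letter \<Rightarrow> rat \<Rightarrow> rat" where
  "letter_act (i, True) t =
    (if t \<le> of_nat i then t else if t \<le> of_nat i + 1 then 2 * t - of_nat i else t + 1)"
| "letter_act (i, False) t =
    (if t \<le> of_nat i then t else if t \<le> of_nat i + 2 then (t + of_nat i) / 2 else t - 1)"

lemma letter_act_cancel: "letter_act (i, \<not> b) (letter_act (i, b) t) = t"
  by (cases b) (auto simp: field_simps)

text \<open>As \<open>i + 1 \<le> j\<close>, generator \<open>i\<close> translates by 1 all points
  that generator \<open>j\<close> moves, so it conjugates that generator into its successor.\<close>

lemma letter_act_relation:
  assumes "i < j"
  shows "letter_act (i, True) (letter_act (j, True) t)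
    = letter_act (Suc j, True) (letter_act (i, True) t)"
proof -
  have "of_nat i + 1 \<le> (of_nat j :: rat)"
    using assms by (metis Suc_leI of_nat_Suc of_nat_le_iff add.commute)
  then show ?thesis by auto
qed

lemma strict_mono_letter_act: "strict_mono (letter_act l)"
proof -
  obtain i b where "l = (i, b)" by fastforce
  then show ?thesis
    by (cases b) (auto intro!: strict_monoI simp: field_simps)
qed

text \<open>A right action: the leftmost letter acts first.\<close>

lift_definition act :: "thompson_F \<Rightarrow> rat \<Rightarrow> rat" is "fold letter_act"
  subgoal for u v
    by (induction rule: F_equiv.induct)
      (auto simp: fun_eq_iff letter_act_cancel letter_act_relation simp del: letter_act.simps)
  done

lemma act_simps [simp]:
  "act 0 t = t" "act (g + h) t = act h (act g t)" "act (gen i) t = letter_act (i, True) t"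
  by (transfer; simp)+

lemma strict_mono_act: "strict_mono (act g)"
proof transfer
  fix w show "strict_mono (fold letter_act w)"
    by (induction w) (use strict_mono_letter_act in \<open>auto simp: strict_mono_def\<close>)
qed

lemma surj_act_gen: "\<exists>s. act (gen i) s = t"
  using letter_act_cancel[of i False t] by (auto simp del: letter_act.simps)

lemma act_word_ge: "t \<le> act (word us) t"
proof (induction us arbitrary: t)
  case (Cons i us)
  have "t \<le> letter_act (i, True) t" by auto
  also have "\<dots> \<le> act (word us) \<dots>" by (rule Cons.IH)
  finally show ?case by (simp del: letter_act.simps)
qed simp

lemma act_word_fixes: "(\<And>i. i \<in> set us \<Longrightarrow> t \<le> of_nat i) \<Longrightarrow> act (word us) t = t"
  by (induction us) auto

lemma act_word_Cons_gt: "of_nat i < t \<Longrightarrow> t < act (word (i # us)) t"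
  using act_word_ge[of "letter_act (i, True) t" us] by (auto split: if_splits)

text \<open>The point \<open>j\<close> separates the maps: all letters from \<open>j\<close> on fix
  it, whereas \<open>i\<close> moves it up and no positive letter moves it back down.\<close>

lemma act_sorted_word_Cons_neq:
  assumes "sorted (j # vs)" "i < j"
  shows "act (word (i # us)) \<noteq> act (word (j # vs))"
proof -
  have "act (word (j # vs)) (of_nat j) = of_nat j"
    using assms by (intro act_word_fixes) auto
  moreover have "of_nat j < act (word (i # us)) (of_nat j)"
    using assms by (intro act_word_Cons_gt) simp
  ultimately show ?thesis by (metis less_irrefl)
qed

text \<open>First letters agree by the preceding separation. The common first letter acts first and
  is surjective, so it cancels.\<close>

lemma act_sorted_word_inj:
  "\<lbrakk>sorted us; sorted vs; act (word us) = act (word vs)\<rbrakk> \<Longrightarrow> us = vs"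
proof (induction us arbitrary: vs)
  case Nil
  show ?case
  proof (cases vs)
    case (Cons j vs')
    have "act (word vs) t = t" for t
      using fun_cong[OF Nil.prems(3), of t] by simp
    with Cons act_word_Cons_gt[of j "of_nat j + 1" vs'] show ?thesis
      by (metis less_add_one less_irrefl)
  qed simp
next
  case (Cons i us)
  show ?case
  proof (cases vs)
    case Nil
    then have "act (word (i # us)) t = t" for t
      using fun_cong[OF Cons.prems(3), of t] by simp
    with act_word_Cons_gt[of i "of_nat i + 1" us] show ?thesis
      by (metis less_add_one less_irrefl)
  next
    case vs: (Cons j vs')
    have "i = j"
      using Cons.prems act_sorted_word_Cons_neq[of j vs' i us] act_sorted_word_Cons_neq[of i us j vs']
      unfolding vs by (metis linorder_neqE_nat)
    moreover have "act (word us) t = act (word vs') t" for t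
    proof -
      obtain s where "act (gen i) s = t" using surj_act_gen by blast
      with fun_cong[OF Cons.prems(3), of s] show ?thesis
        by (simp add: vs \<open>i = j\<close> del: letter_act.simps)
    qed
    ultimately show ?thesis
      using Cons.IH[of vs'] Cons.prems vs by auto
  qed
qed

lemma inj_on_act_positive: "inj_on act (range word)"
proof (rule inj_onI)
  fix g h assume "g \<in> range word" "h \<in> range word" and eq: "act g = act h"
  then obtain us vs where "g = word us" "sorted us" "h = word vs" "sorted vs"
    by (metis word_sorted_exists rangeE)
  with eq act_sorted_word_inj show "g = h" by blast
qed

text \<open>
  Restricting to the factors with extremal action at a point where two elements of \<open>A\<close> differ
  makes \<open>A\<close> smaller without creating new coincidences between products.
\<close>

lemma unique_product:
  assumes "finite A" "A \<noteq> {}" "finite B" "B \<noteq> {}" "inj_on act A"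
  shows "\<exists>a\<in>A. \<exists>b\<in>B. \<forall>a'\<in>A. \<forall>b'\<in>B. a' + b' = a + b \<longrightarrow> a' = a \<and> b' = b"
  using assms
proof (induction "card A" arbitrary: A B rule: less_induct)
  case less
  show ?case
  proof (cases "\<exists>a. A = {a}")
    case True
    with less.prems show ?thesis by auto
  next
    case False
    then obtain a1 a2 where "a1 \<in> A" "a2 \<in> A" "a1 \<noteq> a2"
      using less.prems(2) by blast
    then obtain t where t: "act a1 t \<noteq> act a2 t"
      using less.prems(5) by (auto simp: inj_on_def fun_eq_iff)
    define s where "s = Max ((\<lambda>a. act a t) ` A)"
    define m where "m = Max ((\<lambda>b. act b s) ` B)"
    define A' where "A' = {a \<in> A. act a t = s}"
    define B' where "B' = {b \<in> B. act b s = m}"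
    have s_ge: "act a t \<le> s" if "a \<in> A" for a
      unfolding s_def using less.prems that by (intro Max_ge) auto
    have m_ge: "act b s \<le> m" if "b \<in> B" for b
      unfolding m_def using less.prems that by (intro Max_ge) auto
    have "s \<in> (\<lambda>a. act a t) ` A" "m \<in> (\<lambda>b. act b s) ` B"
      unfolding s_def m_def using less.prems by (auto intro!: Max_in)
    then have "A' \<noteq> {}" "B' \<noteq> {}"
      unfolding A'_def B'_def by auto
    moreover have "A' \<subset> A"
      using t \<open>a1 \<in> A\<close> \<open>a2 \<in> A\<close> unfolding A'_def 
      by (metis (mono_tags, lifting) mem_Collect_eq psubsetI subsetI)
    moreover have "finite A'" "finite B'"
      using less.prems unfolding A'_def B'_def by simp_all
    ultimately obtain a b where ab: "a \<in> A'" "b \<in> B'"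
        and unique: "\<forall>a'\<in>A'. \<forall>b'\<in>B'. a' + b' = a + b \<longrightarrow> a' = a \<and> b' = b"
      using less.hyps[of A' B'] psubset_card_mono[of A A'] less.prems inj_on_subset[of act A A']
      by blast
    \<comment> \<open>If \<open>a'\<close> missed the maximum \<open>s\<close> at \<open>t\<close>,
      strict monotonicity of \<open>b'\<close> would push the final value below
      \<open>m\<close>.\<close>
    have "a' \<in> A' \<and> b' \<in> B'" if "a' \<in> A" "b' \<in> B" "a' + b' = a + b" for a' b'
    proof -
      have "act b' (act a' t) = act (a + b) t"
        using that by (metis act_simps(2))
      also have "\<dots> = m"
        using ab by (simp add: A'_def B'_def)
      finally have *: "act b' (act a' t) = m" .
      have "act a' t = s"
      proof (rule ccontr)
        assume "act a' t \<noteq> s"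
        with s_ge[OF that(1)] have "act b' (act a' t) < act b' s"
          using strict_mono_act by (simp add: strict_mono_def)
        with * m_ge[OF that(2)] show False by simp
      qed
      with * that show ?thesis by (simp add: A'_def B'_def)
    qed
    with ab unique show ?thesis
      unfolding A'_def B'_def by blast
  qed
qed

subsection \<open>Homogeneous elements of the group ring\<close>

definition words :: "nat \<Rightarrow> nat \<Rightarrow> thompson_F set" where
  "words b d = word ` {us. length us = d \<and> (\<forall>i\<in>set us. b \<le> i)}"

definition supported :: "thompson_F set \<Rightarrow> (thompson_F \<Rightarrow>\<^sub>0 'k::field) \<Rightarrow> bool" where
  "supported A f \<longleftrightarrow> Poly_Mapping.keys f \<subseteq> A"

lemma supported_zero: "supported A 0"
  by (simp add: supported_def)

lemma supported_single: "g \<in> A \<Longrightarrow> supported A (Poly_Mapping.single g c)"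
  by (simp add: supported_def)

lemma supported_diff: "supported A f \<Longrightarrow> supported A g \<Longrightarrow> supported A (f - g)"
  by (auto simp: supported_def in_keys_iff lookup_minus subset_iff) (metis diff_0_right)

lemma supported_add: "supported A f \<Longrightarrow> supported A g \<Longrightarrow> supported A (f + g)"
  using keys_add[of f g] by (auto simp: supported_def)

lemma supported_mono: "supported A f \<Longrightarrow> A \<subseteq> B \<Longrightarrow> supported B f"
  by (auto simp: supported_def)

lemma supported_mult:
  assumes "supported A f" "supported B g" "\<And>a b. a \<in> A \<Longrightarrow> b \<in> B \<Longrightarrow> a + b \<in> C"
  shows "supported C (f * g)"
  using assms keys_mult[of f g] unfolding supported_def by blast

lemma sum_single_lookup:
  "f = (\<Sum>g\<in>Poly_Mapping.keys f. Poly_Mapping.single g (Poly_Mapping.lookup f g))"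
  by (rule poly_mapping_eqI)
     (simp add: lookup_sum lookup_single when_def in_keys_iff sum.delta)

lemma supported_induct [consumes 1, case_names zero add]:
  assumes "supported A f" "P 0"
    and "\<And>g c h. g \<in> A \<Longrightarrow> P h \<Longrightarrow> P (Poly_Mapping.single g c + h)"
  shows "P f"
proof -
  have "P (\<Sum>g\<in>B. Poly_Mapping.single g (Poly_Mapping.lookup f g))"
    if "finite B" "B \<subseteq> A" for B
    using that by (induction B rule: finite_induct) (use assms in auto)
  with assms(1) show ?thesis
    by (subst sum_single_lookup[of f]) (simp add: supported_def)
qed

text \<open>The coefficient at a uniquely represented product is a product of two non-zero field
  elements.\<close>

lemma positive_mult_nonzero:
  fixes f g :: "thompson_F \<Rightarrow>\<^sub>0 'k::field"
  assumes "f \<noteq> 0" "g \<noteq> 0" "supported (range word) f"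
  shows "f * g \<noteq> 0"
proof -
  let ?A = "Poly_Mapping.keys f" and ?B = "Poly_Mapping.keys g"
  have "?A \<noteq> {}" "?B \<noteq> {}"
    using assms(1,2) sum_single_lookup[of f] sum_single_lookup[of g] by auto
  then obtain a b where ab: "a \<in> ?A" "b \<in> ?B"
      and unique: "\<forall>a'\<in>?A. \<forall>b'\<in>?B. a' + b' = a + b \<longrightarrow> a' = a \<and> b' = b"
    using unique_product[of ?A ?B] inj_on_subset[OF inj_on_act_positive] assms(3)
    unfolding supported_def by (metis finite_keys)
  have "f * g = (\<Sum>a'\<in>?A. \<Sum>b'\<in>?B.
      Poly_Mapping.single (a' + b') (Poly_Mapping.lookup f a' * Poly_Mapping.lookup g b'))"
    by (subst sum_single_lookup[of f], subst sum_single_lookup[of g])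
       (simp only: sum_product mult_single)
  then have "Poly_Mapping.lookup (f * g) (a + b)
    = (\<Sum>a'\<in>?A. \<Sum>b'\<in>?B.
      if a' + b' = a + b then Poly_Mapping.lookup f a' * Poly_Mapping.lookup g b' else 0)"
    by (simp add: lookup_sum lookup_single when_def)
  also have "\<dots> = (\<Sum>a'\<in>?A. \<Sum>b'\<in>?B.
      if b' = b then if a' = a then Poly_Mapping.lookup f a * Poly_Mapping.lookup g b else 0 else 0)"
    using unique by (intro sum.cong refl) auto
  also have "\<dots> = Poly_Mapping.lookup f a * Poly_Mapping.lookup g b"
    using ab by (simp add: sum.delta)
  also have "\<dots> \<noteq> 0"
    using ab by (simp add: in_keys_iff)
  finally show ?thesis by auto
qed

subsection \<open>Conjugation by powers of a generator\<close>

definition shift :: "nat \<Rightarrow> nat \<Rightarrow> (thompson_F \<Rightarrow>\<^sub>0 'k::field) \<Rightarrow> (thompson_F \<Rightarrow>\<^sub>0 'k)" where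
  "shift b n f = Poly_Mapping.single (- word (replicate n b)) 1 * f *
    Poly_Mapping.single (word (replicate n b)) 1"

lemma xgen_power: "xgen b ^ n = Poly_Mapping.single (word (replicate n b)) 1"
  by (induction n) (simp_all add: xgen_def mult_single)

lemma shift_commute: "f * xgen b ^ n = xgen b ^ n * shift b n f"
  by (simp add: shift_def xgen_power mult_single flip: mult.assoc)

lemma shift_zero: "shift b n 0 = 0"
  by (simp add: shift_def)

lemma shift_add: "shift b n (f + g) = shift b n f + shift b n g"
  by (simp add: shift_def algebra_simps)

lemma shift_sum: "shift b n (sum f I) = (\<Sum>i\<in>I. shift b n (f i))"
  by (simp add: shift_def sum_distrib_left sum_distrib_right)

lemma shift_single_word:
  assumes "\<forall>i\<in>set us. b < i"
  shows "shift b n (Poly_Mapping.single (word us) c) =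
    Poly_Mapping.single (word (map (\<lambda>i. i + n) us)) c"
proof -
  have "word us + word (replicate n b) = word (replicate n b) + word (map (\<lambda>i. i + n) us)"
    using word_commute[of "replicate n b" us] assms by simp
  then show ?thesis
    by (simp add: shift_def mult_single add.assoc)
qed

lemma supported_shift:
  assumes "supported (words (Suc b) d) f"
  shows "supported (words (Suc b) d) (shift b n f)"
  using assms
proof (induction rule: supported_induct)
  case (add g c h)
  then obtain us where "g = word us" "length us = d" "\<forall>i\<in>set us. Suc b \<le> i"
    by (auto simp: words_def)
  then have "supported (words (Suc b) d) (shift b n (Poly_Mapping.single g c))"
    by (auto simp: shift_single_word Suc_le_eq words_def trans_less_add1
        intro!: supported_single imageI)
  with add show ?case
    by (simp add: shift_add supported_add)
qed (simp add: shift_zero supported_zero)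

text \<open>Once \<open>n\<close> bounds all indices in \<open>g\<close>, every letter of the
  shifted \<open>f\<close> passes the \<open>d\<close> letters of \<open>g\<close>. The bound
  depends on \<open>g\<close> alone, so one \<open>n\<close> serves all \<open>f\<close>.\<close>

lemma shift_mult_eventually:
  fixes g :: "thompson_F \<Rightarrow>\<^sub>0 'k::field"
  assumes "supported (words (Suc b) d) g"
  shows "\<forall>\<^sub>F n in sequentially. \<forall>e (f :: thompson_F \<Rightarrow>\<^sub>0 'k).
    supported (words (Suc b) e) f \<longrightarrow> shift b n f * g = g * shift b (n + d) f"
  using assms
proof (induction rule: supported_induct)
  case (add g c h)
  then obtain vs where vs: "g = word vs" "length vs = d"
    by (auto simp: words_def)
  have single: "shift b n f * Poly_Mapping.single g c = Poly_Mapping.single g c * shift b (n + d) f"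
    if n: "\<forall>i\<in>set vs. i \<le> n" and f: "supported (words (Suc b) e) f"
    for n e and f :: "thompson_F \<Rightarrow>\<^sub>0 'k"
    using f
  proof (induction rule: supported_induct)
    case (add h c' h')
    then obtain us where us: "h = word us" "\<forall>i\<in>set us. b < i"
      by (auto simp: words_def Suc_le_eq)
    \<comment> \<open>Indices in \<open>us\<close> exceed \<open>b\<close>, hence are at least 1,
      and after the shift they exceed \<open>n\<close>.\<close>
    have "i < j" if "i \<in> set vs" "j \<in> set (map (\<lambda>i. i + n) us)" for i j
      using n us that by fastforce
    then have "word (map (\<lambda>i. i + n) us) + g = g + word (map (\<lambda>i. i + (n + d)) us)"
      using word_commute[of vs "map (\<lambda>i. i + n) us"] vs by (simp add: comp_def add.assoc)
    with us add.IH show ?case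
      by (simp add: shift_add shift_single_word mult_single algebra_simps)
  qed (simp add: shift_zero)
  have "\<forall>\<^sub>F n in sequentially. \<forall>i\<in>set vs. i \<le> n"
    by (intro eventually_ball_finite) (auto intro: eventually_ge_at_top)
  with add.IH show ?case
    by eventually_elim (use single in \<open>simp add: distrib_left distrib_right\<close>)
qed simp

subsection \<open>Common right multiples\<close>

text \<open>A geometric sum: \<open>x ^ n\<close> is congruent to 1 modulo the right ideal of
  \<open>1 - x\<close>.\<close>

lemma one_minus_dvd_power:
  fixes x :: "'a::ring_1"
  shows "\<exists>q. x ^ n - 1 = (1 - x) * q"
proof (induction n)
  case (Suc n)
  then obtain q where "x ^ n - 1 = (1 - x) * q" by blast
  then have "x ^ Suc n - 1 = (1 - x) * (q - x ^ n)"
    by (simp add: algebra_simps)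
  then show ?case by blast
qed (auto intro: exI[of _ 0])

lemma words_mono: "b \<le> c \<Longrightarrow> words c d \<subseteq> words b d"
  by (fastforce simp: words_def)

lemma words_plus: "g \<in> words b d \<Longrightarrow> h \<in> words b e \<Longrightarrow> g + h \<in> words b (d + e)"
proof -
  assume "g \<in> words b d" "h \<in> words b e"
  then obtain us vs where "g = word us" "length us = d" "\<forall>i\<in>set us. b \<le> i"
    "h = word vs" "length vs = e" "\<forall>i\<in>set vs. b \<le> i"
    by (auto simp: words_def)
  then show ?thesis
    unfolding words_def by (intro image_eqI[of _ _ "us @ vs"]) auto
qed

lemma homogeneous_mult:
  "supported (words b d) f \<Longrightarrow> supported (words b e) g \<Longrightarrow> supported (words b (d + e)) (f * g)"
  by (erule (1) supported_mult) (rule words_plus)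

lemma len_words: "g \<in> words b d \<Longrightarrow> len g = int d"
  by (auto simp: words_def)

lemma power_in_words: "word (replicate n b) \<in> words b n"
  by (auto simp: words_def)

text \<open>Mixed degrees must be allowed: \<open>1 - xgen b\<close> is already
  inhomogeneous.\<close>

definition positive :: "nat \<Rightarrow> (thompson_F \<Rightarrow>\<^sub>0 'k::field) \<Rightarrow> bool" where
  "positive b = supported (\<Union>d. words b d)"

lemma positive_if_supported_words: "supported (words c d) f \<Longrightarrow> b \<le> c \<Longrightarrow> positive b f"
  using words_mono[of b c d] by (auto simp: positive_def intro: supported_mono)

lemma positive_diff: "positive b f \<Longrightarrow> positive b g \<Longrightarrow> positive b (f - g)"
  by (simp add: positive_def supported_diff)

lemma positive_mult: "positive b f \<Longrightarrow> positive b g \<Longrightarrow> positive b (f * g)"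
  unfolding positive_def by (erule (1) supported_mult) (auto dest: words_plus)

lemma positive_Suc: "positive (Suc b) f \<Longrightarrow> positive b f"
  unfolding positive_def using words_mono[of b "Suc b"] by (auto elim!: supported_mono)

lemma positive_mult_eq_0_iff: "positive b f \<Longrightarrow> f * g = 0 \<longleftrightarrow> f = 0 \<or> g = 0"
proof -
  assume "positive b f"
  then have "supported (range word) f"
    unfolding positive_def by (rule supported_mono) (auto simp: words_def)
  then show ?thesis
    using positive_mult_nonzero[of f g] by auto
qed

lemma supported_disjoint_eq_0:
  "supported A f \<Longrightarrow> supported B f \<Longrightarrow> A \<inter> B = {} \<Longrightarrow> f = 0"
  using sum_single_lookup[of f] by (auto simp: supported_def) (metis inf.boundedI subset_empty sum.empty)

lemma homogeneous_two_lengths_eq_0: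
  assumes "supported (words b d) f" "supported (words c e) f" "d \<noteq> e"
  shows "f = 0"
proof (rule supported_disjoint_eq_0[OF assms(1,2)])
  show "words b d \<inter> words c e = {}"
    using assms(3) by (auto dest!: len_words)
qed

text \<open>
  Modulo the right ideal of \<open>1 - x\<^sub>b\<close>, right multiplication by \<open>x\<^sub>b\<^sup>n\<close> acts as \<open>shift b n\<close>.
  Hence multiplying \<open>r\<close> by \<open>x\<^sub>b\<^sup>n r\<^sub>j - shift b (n + e\<^sub>j) r\<^sub>j\<close> gives
  \<open>shift b n r * r\<^sub>j - r * shift b (n + e\<^sub>j) r\<^sub>j\<close>, from which the \<open>j\<close>-th homogeneous summand
  cancels when \<open>n\<close> is large; the other summands remain homogeneous.
\<close>

lemma homogeneous_sum_right_multiple: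
  fixes r :: "'i \<Rightarrow> (thompson_F \<Rightarrow>\<^sub>0 'k::field)"
  assumes "finite I" "\<And>i. i \<in> I \<Longrightarrow> supported (words (Suc b) (e i)) (r i)"
  shows "\<exists>v z. v \<noteq> 0 \<and> positive b v \<and> sum r I * v = (1 - xgen b) * z"
  using assms
proof (induction I arbitrary: r e rule: finite_induct)
  case empty
  have "supported (words b 0) (1 :: thompson_F \<Rightarrow>\<^sub>0 'k)"
    using power_in_words[of 0 b] supported_single[of 0 "words b 0" "1 :: 'k"] by simp
  then have "positive b (1 :: thompson_F \<Rightarrow>\<^sub>0 'k)"
    by (rule positive_if_supported_words) simp
  then show ?case
    by (intro exI[of _ 1] exI[of _ 0]) simp
next
  case (insert j I)
  let ?x = "xgen b :: thompson_F \<Rightarrow>\<^sub>0 'k"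
  show ?case
  proof (cases "r j = 0")
    \<comment> \<open>A zero summand is dropped at once; the factor \<open>v\<close> built from it
      below would be zero.\<close>
    case True
    with insert.hyps insert.IH[of e r] insert.prems show ?thesis by simp
  next
    case False
    define R where "R = sum r (insert j I)"
    \<comment> \<open>With \<open>n \<ge> 1\<close> the two terms of \<open>v\<close> have different
      degrees, which gives \<open>v \<noteq> 0\<close>.\<close>
    have "\<forall>\<^sub>F n in sequentially. n \<ge> 1 \<and> (\<forall>d f. supported (words (Suc b) d) f \<longrightarrow>
        shift b n f * r j = r j * shift b (n + e j) f)"
      using shift_mult_eventually[of b "e j" "r j"] insert.prems eventually_ge_at_top
      by (intro eventually_conj) auto
    then obtain n where n: "n \<ge> 1"
        and comm: "\<And>d f. supported (words (Suc b) d) f \<Longrightarrow>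
          shift b n f * r j = r j * shift b (n + e j) f"
      by (auto dest!: eventually_happens)
    define t where "t = shift b (n + e j) (r j)"
    define v where "v = ?x ^ n * r j - t"
    define s where "s i = r j * shift b (n + e j) (r i) - r i * t" for i
    have rj: "supported (words (Suc b) (e j)) (r j)" and t: "supported (words (Suc b) (e j)) t"
      using insert.prems by (simp_all add: t_def supported_shift)
    have s: "supported (words (Suc b) (e i + e j)) (s i)" if "i \<in> I" for i
    proof -
      have ri: "supported (words (Suc b) (e i)) (r i)"
        using insert.prems that by simp
      show ?thesis
        using homogeneous_mult[OF rj supported_shift[OF ri]] homogeneous_mult[OF ri t]
        unfolding s_def by (intro supported_diff) (simp_all add: add.commute)
    qed
    from insert.IH[of "\<lambda>i. e i + e j" s, OF s] obtain v' z' where v': "v' \<noteq> 0" "positive b v'"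
        and z': "sum s I * v' = (1 - ?x) * z'"
      by blast
    obtain q where q: "?x ^ n - 1 = (1 - ?x) * q"
      using one_minus_dvd_power by blast
    have xn: "supported (words b n) (?x ^ n)"
      by (simp add: xgen_power supported_single power_in_words)
    have xnrj: "supported (words b (n + e j)) (?x ^ n * r j)"
      using xn supported_mono[OF rj words_mono] by (intro homogeneous_mult) simp_all
    have "v \<noteq> 0"
    proof
      assume "v = 0"
      then have "?x ^ n * r j = 0"
        using homogeneous_two_lengths_eq_0[OF xnrj, of "Suc b" "e j"] t n by (simp add: v_def)
      with False show False
        using positive_mult_eq_0_iff[of b "?x ^ n" "r j"] positive_if_supported_words[OF xn]
        by (simp add: xgen_power) (metis lookup_single_eq lookup_zero zero_neq_one)
    qed
    moreover have "positive b v"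
      unfolding v_def
      using positive_diff[OF positive_if_supported_words[OF xnrj] positive_if_supported_words[OF t]]
      by simp
    ultimately have "v * v' \<noteq> 0" "positive b (v * v')"
      using v' by (simp_all add: positive_mult_eq_0_iff positive_mult)
    moreover have "R * (v * v') = (1 - ?x) * (q * shift b n R * r j * v' + z')"
    proof -
      have "shift b n R * r j - R * t = (\<Sum>i\<in>insert j I. shift b n (r i) * r j - r i * t)"
        by (simp add: R_def shift_sum sum_distrib_right sum_subtractf del: sum.insert)
      also have "\<dots> = sum s (insert j I)"
        using comm insert.prems by (intro sum.cong) (auto simp: s_def)
      also have "\<dots> = sum s I"
        using insert.hyps by (simp add: s_def t_def)
      finally have sum_s: "shift b n R * r j - R * t = sum s I" .
      \<comment> \<open>Move \<open>?x ^ n\<close> to the left of \<open>R\<close> and split it as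
        \<open>(?x ^ n - 1) + 1\<close>: the first part lies in the ideal, the second leaves
        \<open>sum s I\<close>.\<close>
      have "R * v = (?x ^ n - 1) * shift b n R * r j + sum s I"
        by (simp add: v_def right_diff_distrib left_diff_distrib shift_commute
            flip: sum_s mult.assoc)
      then show ?thesis
        by (simp add: q z' distrib_left distrib_right mult.assoc flip: mult.assoc[of R])
    qed
    ultimately show ?thesis
      unfolding R_def by blast
  qed
qed

text \<open>Every single term of \<open>r\<close> is homogeneous, so \<open>r\<close> is a sum of
  homogeneous elements indexed by its support.\<close>

lemma positive_right_multiple:
  fixes r :: "thompson_F \<Rightarrow>\<^sub>0 'k::field"
  assumes "positive (Suc b) r"
  shows "\<exists>v z. v \<noteq> 0 \<and> positive b v \<and> r * v = (1 - xgen b) * z"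
proof -
  have "\<exists>d. g \<in> words (Suc b) d" if "g \<in> Poly_Mapping.keys r" for g
    using assms that by (auto simp: positive_def supported_def)
  then obtain e where "g \<in> words (Suc b) (e g)" if "g \<in> Poly_Mapping.keys r" for g
    by metis
  then have "\<exists>v z. v \<noteq> 0 \<and> positive b v \<and>
      (\<Sum>g\<in>Poly_Mapping.keys r. Poly_Mapping.single g (Poly_Mapping.lookup r g)) * v
      = (1 - xgen b) * z"
    by (intro homogeneous_sum_right_multiple[where e = e]) (simp_all add: supported_single)
  then show ?thesis
    by (simp flip: sum_single_lookup)
qed

text \<open>The start \<open>b\<close> varies because the induction step uses a multiple for the
  range from \<open>Suc b\<close>. Positivity is carried along to make the next factor available and
  products non-zero.\<close>

lemma common_right_multiple:
  "\<exists>w :: thompson_F \<Rightarrow>\<^sub>0 'k::field. w \<noteq> 0 \<and> positive b w \<and>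
    (\<forall>i. b \<le> i \<and> i \<le> b + m \<longrightarrow> (\<exists>u. w = (1 - xgen i) * u))"
proof (induction m arbitrary: b)
  case 0
  let ?x = "xgen b :: thompson_F \<Rightarrow>\<^sub>0 'k"
  have one: "supported (words b 0) (1 :: thompson_F \<Rightarrow>\<^sub>0 'k)"
    using power_in_words[of 0 b] supported_single[of 0 "words b 0" "1 :: 'k"] by simp
  have x: "supported (words b 1) ?x"
    using power_in_words[of 1 b] by (simp add: xgen_def supported_single)
  \<comment> \<open>Otherwise 1 would be homogeneous of degrees 0 and 1 at once, hence zero.\<close>
  have "1 - ?x \<noteq> 0"
    using homogeneous_two_lengths_eq_0[OF one, of b 1] x by auto
  moreover have "positive b (1 - ?x)"
    using one x by (auto intro: positive_diff positive_if_supported_words)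
  ultimately show ?case
    by (intro exI[of _ "1 - ?x"]) (auto intro: exI[of _ 1])
next
  case (Suc m)
  obtain r :: "thompson_F \<Rightarrow>\<^sub>0 'k" where r: "r \<noteq> 0" "positive (Suc b) r"
      and multiple: "\<And>i. Suc b \<le> i \<Longrightarrow> i \<le> Suc b + m \<Longrightarrow> \<exists>u. r = (1 - xgen i) * u"
    using Suc.IH[of "Suc b"] by blast
  obtain v z where v: "v \<noteq> 0" "positive b v" and z: "r * v = (1 - xgen b) * z"
    using positive_right_multiple[OF r(2)] by blast
  have "\<exists>u. r * v = (1 - xgen i) * u" if "b \<le> i" "i \<le> b + Suc m" for i
  proof (cases "i = b")
    case False
    with multiple[of i] that show ?thesis by (auto simp: mult.assoc)
  qed (use z in blast)
  moreover have "r * v \<noteq> 0" "positive b (r * v)"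
    using r v by (simp_all add: positive_mult_eq_0_iff positive_mult positive_Suc)
  ultimately show ?case by blast
qed

theorem corollary2:
  fixes m :: nat
  assumes "m \<ge> 1"
  shows "\<exists>u :: nat \<Rightarrow> (thompson_F \<Rightarrow>\<^sub>0 'k::field).
    (\<exists>i\<le>m. u i \<noteq> 0) \<and> (\<forall>i\<le>m. \<forall>j\<le>m. (1 - xgen i) * u i = (1 - xgen j) * u j)"
proof -
  obtain w :: "thompson_F \<Rightarrow>\<^sub>0 'k" where "w \<noteq> 0" "\<forall>i\<le>m. \<exists>u. w = (1 - xgen i) * u"
    using common_right_multiple[of 0 m] by auto
  then obtain u where u: "\<And>i. i \<le> m \<Longrightarrow> w = (1 - xgen i) * u i"
    by metis
  then have "u 0 \<noteq> 0"
    using \<open>w \<noteq> 0\<close> by fastforce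
  with u show ?thesis
    by (intro exI[of _ u]) (metis le0)
qed

end
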